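(* For any constant $\epsilon>0$, HERALD* with the logarithmic score function preserves $\frac{\epsilon l}{2}$-differential privacy, where $l$ is the number of task subsets. That is, let $M$ be the randomized map that sends a bid profile $\overrightarrow{b}=(b_1,\dots,b_m)\in[b_{\min},b_{\max}]^m$ to the task-worker matching result obtained by drawing, for each of the $l$ task subsets $\Gamma_1,\dots,\Gamma_l$ independently, a worker $i\in\mathcal{W}$ with probability $$\Pr(b_i)=\frac{\exp\left(\frac{-\epsilon\ln(b_i/b_{\max})}{2\ln b_{\max}}\right)}{\sum_{j\in\mathcal{W}}\exp\left(\frac{-\epsilon\ln(b_j/b_{\max})}{2\ln b_{\max}}\right)}.$$ Then for any two bid profiles $\overrightarrow{b},\overrightarrow{b}'$ differing in only one bid and any set $\mathcal{O}$ of matching results, $$\Pr[M(\overrightarrow{b})\in\mathcal{O}]\le \exp\left(\frac{\epsilon l}{2}\right)\Pr[M(\overrightarrow{b}')\in\mathcal{O}].$$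
   Context: $\mathcal{W}=\{1,\dots,m\}$ is the set of workers; worker $i$ submits a bid $b_i\in[b_{\min},b_{\max}]$, where $b_{\min}=1$ and $b_{\max}>b_{\min}$ is a constant. $\mathcal{Y}=\{\Gamma_1,\dots,\Gamma_l\}$ is a family of $l$ task subsets. The matching phase of the mechanism HERALD* assigns to each task subset one worker; a worker may be assigned several subsets. A matching result is the record of which worker is matched with each of $\Gamma_1,\dots,\Gamma_l$. The logarithmic score function is $f_{\ln}(x)=-\ln x$; inserted (with bids normalized by $b_{\max}$, with sensitivity $\Delta u=\ln b_{\max}$) in the exponential mechanism, which selects with probability proportional to $\exp(\epsilon u/(2\Delta u))$, it gives the displayed matching probabilities. A randomized mechanism $M$ preserves $\epsilon'$-differential privacy if for any two inputs $A,B$ differing in a single entry and any set $\mathcal{O}$ of outputs, $\Pr[M(A)\in\mathcal{O}]\le e^{\epsilon'}\Pr[M(B)\in\mathcal{O}]$. *)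

theory Defs
  imports "HOL-Probability.Probability"
begin

text \<open>
  Workers are the indices \<open>1, \<dots>, m\<close> and the task subsets are represented by their
  indices \<open>1, \<dots>, l\<close>.  A bid profile is an extensional function on \<open>{1..m}\<close>, a
  matching result an extensional function from \<open>{1..l}\<close> to \<open>{1..m}\<close>.
\<close>

definition b_min :: real
  where "b_min = 1"

definition bid_profiles :: "nat \<Rightarrow> real \<Rightarrow> (nat \<Rightarrow> real) set"
  where "bid_profiles m b_max = {1..m} \<rightarrow>\<^sub>E {b_min..b_max}"

definition differ_in_one_bid :: "nat \<Rightarrow> (nat \<Rightarrow> real) \<Rightarrow> (nat \<Rightarrow> real) \<Rightarrow> bool"
  where "differ_in_one_bid m b b' \<longleftrightarrow>
    (\<exists>k\<in>{1..m}. b k \<noteq> b' k \<and> (\<forall>j\<in>{1..m} - {k}. b j = b' j))"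

definition differentially_private ::
    "'a set \<Rightarrow> ('a \<Rightarrow> 'a \<Rightarrow> bool) \<Rightarrow> ('a \<Rightarrow> 'r pmf) \<Rightarrow> real \<Rightarrow> bool"
  where "differentially_private D adj M \<epsilon> \<longleftrightarrow>
    (\<forall>A\<in>D. \<forall>B\<in>D. adj A B \<longrightarrow>
      (\<forall>S. measure_pmf.prob (M A) S \<le> exp \<epsilon> * measure_pmf.prob (M B) S))"

text \<open>
  Here \<open>\<Delta>\<close> is the sensitivity and \<open>u\<close> the score of each element of the candidate set
  \<open>C\<close>.  The argument of \<^const>\<open>embed_pmf\<close> is a probability mass function only for finite
  nonempty \<open>C\<close>; see \<open>pmf_exponential_mechanism\<close>.
\<close>

definition exponential_mechanism ::
    "real \<Rightarrow> real \<Rightarrow> 'a set \<Rightarrow> ('a \<Rightarrow> real) \<Rightarrow> 'a pmf"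
  where "exponential_mechanism \<epsilon> \<Delta> C u =
    embed_pmf (\<lambda>i. if i \<in> C
      then exp (\<epsilon> * u i / (2 * \<Delta>)) / (\<Sum>j\<in>C. exp (\<epsilon> * u j / (2 * \<Delta>))) else 0)"

definition f_ln :: "real \<Rightarrow> real"
  where "f_ln x = - ln x"

text \<open>
  The matching phase with score function \<open>f\<close> of sensitivity \<open>\<Delta>\<close>: \<open>l\<close> independent draws
  of a worker, scored by the bids normalized by \<open>b_max\<close>.  Matching results take the
  value \<^const>\<open>undefined\<close> outside \<open>{1..l}\<close>.
\<close>

definition herald_star ::
    "(real \<Rightarrow> real) \<Rightarrow> real \<Rightarrow> nat \<Rightarrow> nat \<Rightarrow> real \<Rightarrow> real \<Rightarrow> (nat \<Rightarrow> real) \<Rightarrow> (nat \<Rightarrow> nat) pmf"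
  where "herald_star f \<Delta> m l b_max \<epsilon> b =
    Pi_pmf {1..l} undefined
      (\<lambda>_. exponential_mechanism \<epsilon> \<Delta> {1..m} (\<lambda>i. f (b i / b_max)))"

lemma pmf_exponential_mechanism:
  assumes "finite C" and "C \<noteq> {}"
  shows "pmf (exponential_mechanism \<epsilon> \<Delta> C u) i =
    (if i \<in> C
     then exp (\<epsilon> * u i / (2 * \<Delta>)) / (\<Sum>j\<in>C. exp (\<epsilon> * u j / (2 * \<Delta>))) else 0)"
proof -
  define w where "w i = exp (\<epsilon> * u i / (2 * \<Delta>))" for i
  define p where "p i = (if i \<in> C then w i / sum w C else 0)" for i
  have pos: "sum w C > 0"
    using assms by (intro sum_pos) (auto simp: w_def)
  have nonneg: "p i \<ge> 0" for i
    using pos by (auto simp: p_def w_def)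
  have "(\<integral>\<^sup>+ i. ennreal (p i) \<partial>count_space UNIV) = (\<integral>\<^sup>+ i. ennreal (p i) \<partial>count_space C)"
    by (rule nn_integral_count_space_eq) (auto simp: p_def)
  also have "\<dots> = (\<Sum>i\<in>C. ennreal (p i))"
    using assms by (simp add: nn_integral_count_space_finite)
  also have "\<dots> = ennreal (\<Sum>i\<in>C. p i)"
    using nonneg by (simp add: sum_ennreal)
  also have "(\<Sum>i\<in>C. p i) = 1"
    using pos by (simp add: p_def flip: sum_divide_distrib)
  finally have "pmf (embed_pmf p) i = p i"
    using nonneg by (simp add: pmf_embed_pmf)
  moreover have "exponential_mechanism \<epsilon> \<Delta> C u = embed_pmf p"
    unfolding exponential_mechanism_def p_def[abs_def] w_def by simp
  ultimately show ?thesis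
    by (simp add: p_def w_def)
qed

lemma pmf_herald_star_ln:
  assumes "m \<ge> 1" and "r \<in> {1..l} \<rightarrow>\<^sub>E {1..m}"
  shows "pmf (herald_star f_ln (ln b_max) m l b_max \<epsilon> b) r =
    (\<Prod>k\<in>{1..l}.
      exp ((- \<epsilon> * ln (b (r k) / b_max)) / (2 * ln b_max)) /
      (\<Sum>j\<in>{1..m}. exp ((- \<epsilon> * ln (b j / b_max)) / (2 * ln b_max))))"
proof -
  have "r k \<in> {1..m}" if "k \<in> {1..l}" for k
    using assms(2) that by auto
  moreover have "r k = undefined" if "k \<notin> {1..l}" for k
    using assms(2) that by (rule PiE_arb)
  ultimately show ?thesis
    using assms(1) unfolding herald_star_def
    by (subst pmf_Pi') (auto simp: pmf_exponential_mechanism f_ln_def intro!: prod.cong)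
qed

lemma set_pmf_herald_star:
  assumes "m \<ge> 1"
  shows "set_pmf (herald_star f \<Delta> m l b_max \<epsilon> b) \<subseteq> {1..l} \<rightarrow>\<^sub>E {1..m}"
proof -
  have "set_pmf (exponential_mechanism \<epsilon> \<Delta> {1..m} u) \<subseteq> {1..m}" for u
    using assms by (auto simp: set_pmf_eq pmf_exponential_mechanism split: if_splits)
  then show ?thesis
    unfolding herald_star_def
    by (subst set_Pi_pmf) (auto simp: PiE_dflt_def PiE_def extensional_def, fastforce+)
qed

end

theory Submission imports Defs begin

text \<open>
  Changing the score of one candidate by at most \<open>\<Delta>\<close> changes its weight by a factor of at
  most \<open>c = exp (\<epsilon> / 2)\<close>. The selection probability of any candidate then also changes by a
  factor of at most \<open>c\<close>, and not \<open>c\<^sup>2\<close>: for an unchanged candidate only the normalizing sum moves,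
  and for the changed one numerator and normalizing sum move in the same direction.
  The \<open>l\<close> draws being independent, these factors multiply to \<open>c ^ l = exp (\<epsilon> l / 2)\<close>.
\<close>

text \<open>The probability of an event is the sum of its point masses, and these are summable over
  any set, so a pointwise bound passes to all events.\<close>

lemma prob_pmf_le_mult:
  assumes "\<And>x. pmf p x \<le> c * pmf q x"
  shows "measure_pmf.prob p S \<le> c * measure_pmf.prob q S"
proof -
  have "infsetsum (pmf p) S \<le> infsetsum (\<lambda>x. c * pmf q x) S"
    by (intro infsetsum_mono abs_summable_on_cmult_right pmf_abs_summable assms)
  then show ?thesis
    by (simp add: measure_pmf_conv_infsetsum infsetsum_cmult_right pmf_abs_summable)
qed

text \<open>Each of the \<open>card A\<close> factors of the product mass costs one
  \<open>c\<close>. If \<open>r\<close> deviates from the default \<open>d\<close> outside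
  \<open>A\<close>, both sides vanish.\<close>

lemma pmf_Pi_pmf_le_mult:
  assumes "finite A" and "\<And>k x. k \<in> A \<Longrightarrow> pmf (p k) x \<le> c * pmf (q k) x"
  shows "pmf (Pi_pmf A d p) r \<le> c ^ card A * pmf (Pi_pmf A d q) r"
proof -
  have "(\<Prod>k\<in>A. pmf (p k) (r k)) \<le> (\<Prod>k\<in>A. c * pmf (q k) (r k))"
    using assms(2) by (intro prod_mono) auto
  then show ?thesis
    using assms(1) by (auto simp: pmf_Pi prod.distrib)
qed

lemma normalized_weight_le_mult:
  fixes w w' :: "'a \<Rightarrow> real"
  assumes C: "finite C" "k \<in> C" "i \<in> C"
    and pos: "\<And>j. j \<in> C \<Longrightarrow> 0 < w j" "\<And>j. j \<in> C \<Longrightarrow> 0 < w' j"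
    and eq: "\<And>j. j \<in> C - {k} \<Longrightarrow> w j = w' j"
    and c: "1 \<le> c" "w k \<le> c * w' k" "w' k \<le> c * w k"
  shows "w i / sum w C \<le> c * (w' i / sum w' C)"
proof -
  define R where "R = sum w (C - {k})"
  have R0: "0 \<le> R"
    unfolding R_def using pos(1) by (intro sum_nonneg) (auto intro: less_imp_le)
  have S: "sum w C = w k + R" "sum w' C = w' k + R"
    unfolding R_def using C sum.cong[OF refl eq, of "C - {k}" "\<lambda>j. j"]
    by (simp_all add: sum.remove[of C k])
  have k: "0 < w k" "0 < w' k"
    using pos C by auto
  have RcR: "R \<le> c * R"
    using c(1) R0 mult_right_mono[of 1 c R] by simp
  \<comment> \<open>This is the claim with denominators cleared; \<open>R\<close> is the weight that
    both normalizing sums share.\<close>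
  have "w i * (w' k + R) \<le> c * w' i * (w k + R)"
  proof (cases "i = k")
    case True
    \<comment> \<open>The product \<open>w k * w' k\<close> occurs on both sides, so the bound on
      \<open>w k\<close> is spent only on the term with \<open>R\<close>.\<close>
    have "w k * w' k \<le> c * (w k * w' k)"
      using c(1) k mult_right_mono[of 1 c "w k * w' k"] by simp
    moreover have "w k * R \<le> c * w' k * R"
      using c(2) R0 by (intro mult_right_mono)
    ultimately show ?thesis
      using True by (simp add: algebra_simps)
  next
    case False
    \<comment> \<open>Here the numerators agree, and \<open>c\<close> is spent on the normalizing
      sum alone.\<close>
    have "w i * (w' k + R) \<le> w i * (c * (w k + R))"
      using c(3) RcR pos(1)[OF C(3)] by (intro mult_left_mono) (auto simp: distrib_left)
    then show ?thesis
      using eq[of i] C False by (simp add: algebra_simps)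
  qed
  then show ?thesis
    using k R0 by (simp add: S divide_simps algebra_simps)
qed

lemma pmf_exponential_mechanism_le_mult:
  assumes C: "finite C" "k \<in> C"
    and eq: "\<And>j. j \<in> C - {k} \<Longrightarrow> u j = u' j"
    and sens: "\<bar>u k - u' k\<bar> \<le> \<Delta>"
    and "0 < \<Delta>" "0 \<le> \<epsilon>"
  shows "pmf (exponential_mechanism \<epsilon> \<Delta> C u) i
    \<le> exp (\<epsilon> / 2) * pmf (exponential_mechanism \<epsilon> \<Delta> C u') i"
proof -
  have weight: "exp (\<epsilon> * a / (2 * \<Delta>)) \<le> exp (\<epsilon> / 2) * exp (\<epsilon> * b / (2 * \<Delta>))"
    if "a - b \<le> \<Delta>" for a b
  proof -
    have "\<epsilon> * a \<le> \<epsilon> * (\<Delta> + b)"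
      using that \<open>0 \<le> \<epsilon>\<close> by (intro mult_left_mono) auto
    then have "\<epsilon> * a / (2 * \<Delta>) \<le> \<epsilon> / 2 + \<epsilon> * b / (2 * \<Delta>)"
      using \<open>0 < \<Delta>\<close> by (simp add: field_simps)
    then show ?thesis
      by (simp flip: exp_add)
  qed
  show ?thesis
  proof (cases "i \<in> C")
    case True
    have "exp (\<epsilon> * u i / (2 * \<Delta>)) / (\<Sum>j\<in>C. exp (\<epsilon> * u j / (2 * \<Delta>)))
      \<le> exp (\<epsilon> / 2) * (exp (\<epsilon> * u' i / (2 * \<Delta>)) / (\<Sum>j\<in>C. exp (\<epsilon> * u' j / (2 * \<Delta>))))"
      using C True eq sens \<open>0 \<le> \<epsilon>\<close>
      \<comment> \<open>The bound \<open>weight\<close> is used in both directions, as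
        \<open>sens\<close> is symmetric in \<open>u\<close> and \<open>u'\<close>.\<close>
      by (intro normalized_weight_le_mult[where k = k] weight) auto
    moreover have "C \<noteq> {}"
      using C by auto
    ultimately show ?thesis
      using C True by (simp add: pmf_exponential_mechanism)
  next
    case False
    moreover have "C \<noteq> {}"
      using C by auto
    ultimately show ?thesis
      using C by (simp add: pmf_exponential_mechanism)
  qed
qed

text \<open>The normalization by \<open>b_max\<close> cancels in the difference, and since
  \<open>b_min\<close> is 1 both logarithms lie between 0 and \<open>ln b_max\<close>.\<close>

lemma f_ln_sensitivity:
  assumes "x \<in> {b_min..b_max}" "y \<in> {b_min..b_max}"
  shows "\<bar>f_ln (x / b_max) - f_ln (y / b_max)\<bar> \<le> ln b_max"
proof -
  have xy: "1 \<le> x" "x \<le> b_max" "1 \<le> y" "y \<le> b_max"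
    using assms by (auto simp: b_min_def)
  then have "f_ln (x / b_max) - f_ln (y / b_max) = ln y - ln x"
    by (simp add: f_ln_def ln_div)
  moreover have "0 \<le> ln x" "ln x \<le> ln b_max" "0 \<le> ln y" "ln y \<le> ln b_max"
    using xy by auto
  ultimately show ?thesis
    by linarith
qed

theorem theorem4:
  fixes m l :: nat and b_max \<epsilon> :: real
  assumes "b_max > b_min"
    and "\<epsilon> > 0"
  shows "differentially_private (bid_profiles m b_max) (differ_in_one_bid m)
    (herald_star f_ln (ln b_max) m l b_max \<epsilon>) (\<epsilon> * real l / 2)"
  unfolding differentially_private_def
proof (intro ballI impI allI)
  fix b b' S
  assume b: "b \<in> bid_profiles m b_max" "b' \<in> bid_profiles m b_max"
    and "differ_in_one_bid m b b'"
  then obtain k where k: "k \<in> {1..m}" "\<forall>j\<in>{1..m} - {k}. b j = b' j"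
    by (auto simp: differ_in_one_bid_def)
  have "b k \<in> {b_min..b_max}" "b' k \<in> {b_min..b_max}"
    using b k(1) unfolding bid_profiles_def by blast+
  then have sens: "\<bar>f_ln (b k / b_max) - f_ln (b' k / b_max)\<bar> \<le> ln b_max"
    by (rule f_ln_sensitivity)
  have draw: "pmf (exponential_mechanism \<epsilon> (ln b_max) {1..m} (\<lambda>i. f_ln (b i / b_max))) i
    \<le> exp (\<epsilon> / 2) *
      pmf (exponential_mechanism \<epsilon> (ln b_max) {1..m} (\<lambda>i. f_ln (b' i / b_max))) i" for i
    \<comment> \<open>Positivity of the sensitivity \<open>ln b_max\<close> comes from
      \<open>b_max > b_min = 1\<close>.\<close>
    using k sens assms
    by (intro pmf_exponential_mechanism_le_mult[where k = k]) (auto simp: b_min_def)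
  have "pmf (herald_star f_ln (ln b_max) m l b_max \<epsilon> b) r
    \<le> exp (\<epsilon> / 2) ^ card {1..l} * pmf (herald_star f_ln (ln b_max) m l b_max \<epsilon> b') r" for r
    unfolding herald_star_def by (intro pmf_Pi_pmf_le_mult draw) simp
  moreover have "exp (\<epsilon> / 2) ^ card {1..l} = exp (\<epsilon> * real l / 2)"
    by (simp flip: exp_of_nat_mult add: mult.commute)
  ultimately show "measure_pmf.prob (herald_star f_ln (ln b_max) m l b_max \<epsilon> b) S
    \<le> exp (\<epsilon> * real l / 2) * measure_pmf.prob (herald_star f_ln (ln b_max) m l b_max \<epsilon> b') S"
    by (intro prob_pmf_le_mult) simp
qed

end
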